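(* In the multicell downlink model with transceiver impairments described in the context, let $\gamma_{i,j}\ge 0$ be given for all $i,j$, and consider the problem $$(\mathrm{P1})\qquad \begin{aligned}\underset{\beta,\ \mathbf{W}_i\ \forall i}{\text{minimize}}\quad & \beta\\ \text{subject to}\quad & g_{i,j}(\mathrm{SINR}_{i,j})\ge\gamma_{i,j}\quad\forall i,j,\\ & \mathrm{tr}(\mathbf{W}_i^H\mathbf{Q}_{i,k}\mathbf{W}_i)+\mathrm{tr}(\delta\,\mathbf{Q}_{i,k}\mathbf{C}_i)\le\beta q_{i,k}\quad\forall i,k.\end{aligned}$$ If $\eta(\cdot)$ and $\nu(\cdot)$ are monotonically increasing convex functions, then (P1) can be reformulated into the following convex optimization problem: $$\begin{aligned}\underset{\beta,\ \mathbf{W}_i,\ t_{i,n},\ r_{i,j}\ \forall i,j,n}{\text{minimize}}\quad & \beta\\ \text{subject to}\quad & t_{i,n}\ge 0,\quad r_{i,j}\ge 0,\quad \Im(\mathbf{h}_{i,i,j}^H\mathbf{w}_{i,j})=0\quad\forall i,j,n,\\ & \mathrm{tr}(\mathbf{W}_i^H\mathbf{Q}_{i,k}\mathbf{W}_i)+\sum_{n}\mathrm{tr}(\delta\,\mathbf{Q}_{i,k}\mathbf{T}_n)\,t_{i,n}^2\le\beta q_{i,k}\quad\forall i,k,\\ & \sqrt{\sum_{m}\|\mathbf{h}_{m,i,j}^H\mathbf{W}_m\|_F^2+\sum_{m,n}(\mathbf{h}_{m,i,j}^H\mathbf{T}_n\mathbf{h}_{m,i,j})\,t_{m,n}^2+r_{i,j}^2+\sigma^2}\\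 &\qquad\le\sqrt{1+\frac{1}{g_{i,j}^{-1}(\gamma_{i,j})}}\ \Re(\mathbf{h}_{i,i,j}^H\mathbf{w}_{i,j})\quad\forall i,j,\\ & \eta(\|\mathbf{T}_n\mathbf{W}_m\|_F)\le t_{m,n}\quad\forall m,n,\\ & \nu\Big(\sqrt{\textstyle\sum_m\|\mathbf{h}_{m,i,j}^H\mathbf{W}_m\|_F^2}\Big)\le r_{i,j}\quad\forall i,j.\end{aligned}$$
   Context: Model. There are $N$ cells, each with one base station having $N_t$ antennas and $K$ single-antenna users. $\mathbf{h}_{m,i,j}\in\mathbb{C}^{N_t}$ is the (perfectly known) channel vector from base station $m$ to user $j$ of cell $i$. $\mathbf{w}_{i,j}\in\mathbb{C}^{N_t}$ is the beamforming vector for user $j$ of cell $i$ and $\mathbf{W}_i=[\mathbf{w}_{i,1}\ \cdots\ \mathbf{w}_{i,K}]\in\mathbb{C}^{N_t\times K}$. Indices: $i,m\in\{1,\dots,N\}$, $j,l\in\{1,\dots,K\}$, $n\in\{1,\dots,N_t\}$. $(\cdot)^H$ is conjugate transpose, $\|\cdot\|_F$ the Frobenius norm, $\Re,\Im$ real and imaginary parts. The auxiliary variables $t_{i,n}$ and $r_{i,j}$ are real scalars. Impairments. $\mathbf{T}_n\in\mathbb{C}^{N_t\times N_t}$ has $n$th diagonal element equal to one and all other elements zero. $\eta,\nu:[0,\infty)\to[0,\infty)$ are monotonically increasing continuous functions giving distortion magnitudes as functions of signal magnitude. The transmitter-distortion covariance of base station $m$ is the diagonal matrix $\mathbf{C}_m=\mathrm{diag}(c_{m,1}^2,\dots,c_{m,N_t}^2)$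 with $c_{m,n}=\eta(\|\mathbf{T}_n\mathbf{W}_m\|_F)$. The thermal noise power is $\sigma^2$, and the receiver-distortion variance is $\sigma_{i,j}^2=\sigma^2+\nu^2\big(\sqrt{\sum_{m=1}^N\|\mathbf{h}_{m,i,j}^H\mathbf{W}_m\|_F^2}\big)$, where $\nu^2(x)=(\nu(x))^2$. Power constraints. For each cell $i$ and $k=1,\dots,L_i$, $\mathbf{Q}_{i,k}\in\mathbb{C}^{N_t\times N_t}$ is positive semidefinite, with $\sum_{k=1}^{L_i}\mathbf{Q}_{i,k}\succ 0$ for every $i$; $q_{i,k}$ are the power limits; $\delta\in[0,1]$ is a fixed parameter. The variable $\beta$ scales the power limits. SINR and performance. $$\mathrm{SINR}_{i,j}=\frac{|\mathbf{h}_{i,i,j}^H\mathbf{w}_{i,j}|^2}{\sum_{l\ne j}|\mathbf{h}_{i,i,j}^H\mathbf{w}_{i,l}|^2+\sum_{m\ne i}\|\mathbf{h}_{m,i,j}^H\mathbf{W}_m\|_F^2+\sum_m\mathbf{h}_{m,i,j}^H\mathbf{C}_m\mathbf{h}_{m,i,j}+\sigma_{i,j}^2}.$$ Each $g_{i,j}$ is a strictly increasing continuous function of the SINR with $g_{i,j}(0)=0$, and $g_{i,j}^{-1}$ is its inverse. The numbers $\gamma_{i,j}$ are quality-of-service targets.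
   Formalization: Where γ_{i,j}=0 the factor √(1+1/g^{-1}(γ)) is undefined; the constraint is then read as Re(h^H w) ≥ 0. If γ_{i,j} is outside the range of g, the factor is read as 1 (both problems are infeasible). The noise power σ² is taken positive so that the SINR is defined. *)

theory Defs
  imports "HOL-Analysis.Analysis"
begin

section \<open>Optimization problems in standard form\<close>

text \<open>Minimize the objective subject to \<open>f x \<le> 0\<close> for each inequality function \<open>f\<close> and
  \<open>e x = 0\<close> for each equality function \<open>e\<close>.  A constraint \<open>a x \<le> b x\<close> is entered as
  the function \<open>\<lambda>x. a x - b x\<close>.\<close>

record 'x opt_problem =
  objective :: "'x \<Rightarrow> real"
  ineqs :: "('x \<Rightarrow> real) set"
  eqs :: "('x \<Rightarrow> real) set"

definition feasible :: "'x opt_problem \<Rightarrow> 'x set" where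
  "feasible P = {x. (\<forall>f \<in> ineqs P. f x \<le> 0) \<and> (\<forall>e \<in> eqs P. e x = 0)}"

definition is_optimal :: "'x opt_problem \<Rightarrow> 'x \<Rightarrow> bool" where
  "is_optimal P x \<longleftrightarrow> x \<in> feasible P \<and> (\<forall>y \<in> feasible P. objective P x \<le> objective P y)"

text \<open>The optimal value is \<open>\<infinity>\<close> for an infeasible problem and \<open>-\<infinity>\<close> for one that is
  unbounded below.\<close>

definition opt_value :: "'x opt_problem \<Rightarrow> ereal" where
  "opt_value P = (INF x \<in> feasible P. ereal (objective P x))"

definition affine_fun :: "('x::real_vector \<Rightarrow> real) \<Rightarrow> bool" where
  "affine_fun f \<longleftrightarrow> (\<exists>l c. linear l \<and> (\<forall>x. f x = l x + c))"

definition convex_problem :: "'x::real_vector opt_problem \<Rightarrow> bool" where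
  "convex_problem P \<longleftrightarrow>
     convex_on UNIV (objective P) \<and>
     (\<forall>f \<in> ineqs P. convex_on UNIV f) \<and>
     (\<forall>e \<in> eqs P. affine_fun e)"


section \<open>Complex vectors and matrices\<close>

definition ctranspose :: "complex^'n^'m \<Rightarrow> complex^'m^'n" where
  "ctranspose A = (\<chi> i j. cnj (A $ j $ i))"

text \<open>\<open>hprod x y\<close> is \<open>x\<^sup>H y\<close>, and \<open>hrow x A\<close> is the row vector \<open>x\<^sup>H A\<close>.\<close>

definition hprod :: "complex^'n \<Rightarrow> complex^'n \<Rightarrow> complex" where
  "hprod x y = (\<Sum>n\<in>UNIV. cnj (x $ n) * y $ n)"

definition hrow :: "complex^'m \<Rightarrow> complex^'n^'m \<Rightarrow> complex^'n" where
  "hrow x A = (\<chi> l. hprod x (column l A))"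

definition psd :: "complex^'n^'n \<Rightarrow> bool" where
  "psd A \<longleftrightarrow> ctranspose A = A \<and> (\<forall>x. 0 \<le> Re (hprod x (A *v x)))"

definition pos_def :: "complex^'n^'n \<Rightarrow> bool" where
  "pos_def A \<longleftrightarrow> ctranspose A = A \<and> (\<forall>x. x \<noteq> 0 \<longrightarrow> 0 < Re (hprod x (A *v x)))"

definition T :: "'n \<Rightarrow> complex^'n^'n" where
  "T n = (\<chi> a b. if a = n \<and> b = n then 1 else 0)"


section \<open>Downlink model with transceiver impairments\<close>

text \<open>The finite types \<open>'c\<close>, \<open>'u\<close>, \<open>'a\<close> index the \<open>N\<close> cells, the \<open>K\<close> users of
  each cell and the \<open>N\<^sub>t\<close> antennas of each base station.  \<open>h m i j\<close> is the channel from base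
  station \<open>m\<close> to user \<open>j\<close> of cell \<open>i\<close>; \<open>W $ i\<close> is the \<open>N\<^sub>t \<times> K\<close> beamforming matrix of
  cell \<open>i\<close>, whose \<open>j\<close>-th column is the beamformer of user \<open>j\<close>.
  The library norm of a matrix of type \<open>complex^'u^'a\<close> is its Frobenius norm.  Traces and
  quadratic forms of Hermitian matrices are real and are converted by \<open>Re\<close>.\<close>

type_synonym ('c, 'u, 'a) channel = "'c \<Rightarrow> 'c \<Rightarrow> 'u \<Rightarrow> complex^'a"
type_synonym ('c, 'u, 'a) beamformers = "complex^'u^'a^'c"

definition tx_distortion ::
  "(real \<Rightarrow> real) \<Rightarrow> ('c::finite, 'u::finite, 'a::finite) beamformers \<Rightarrow> 'c \<Rightarrow> 'a \<Rightarrow> real" where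
  "tx_distortion \<eta> W m n = \<eta> (norm (T n ** (W $ m)))"

definition tx_cov ::
  "(real \<Rightarrow> real) \<Rightarrow> ('c::finite, 'u::finite, 'a::finite) beamformers \<Rightarrow> 'c \<Rightarrow> complex^'a^'a" where
  "tx_cov \<eta> W m = (\<chi> a b. if a = b then of_real ((tx_distortion \<eta> W m a)\<^sup>2) else 0)"

definition rx_power ::
  "('c::finite, 'u::finite, 'a::finite) channel \<Rightarrow> ('c, 'u, 'a) beamformers \<Rightarrow> 'c \<Rightarrow> 'u \<Rightarrow> real" where
  "rx_power h W i j = (\<Sum>m\<in>UNIV. (norm (hrow (h m i j) (W $ m)))\<^sup>2)"

definition rx_variance ::
  "('c::finite, 'u::finite, 'a::finite) channel \<Rightarrow> (real \<Rightarrow> real) \<Rightarrow> real \<Rightarrow>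
   ('c, 'u, 'a) beamformers \<Rightarrow> 'c \<Rightarrow> 'u \<Rightarrow> real" where
  "rx_variance h \<nu> \<sigma> W i j = \<sigma>\<^sup>2 + (\<nu> (sqrt (rx_power h W i j)))\<^sup>2"

definition SINR ::
  "('c::finite, 'u::finite, 'a::finite) channel \<Rightarrow> (real \<Rightarrow> real) \<Rightarrow> (real \<Rightarrow> real) \<Rightarrow> real \<Rightarrow>
   ('c, 'u, 'a) beamformers \<Rightarrow> 'c \<Rightarrow> 'u \<Rightarrow> real" where
  "SINR h \<eta> \<nu> \<sigma> W i j =
     (cmod (hprod (h i i j) (column j (W $ i))))\<^sup>2 /
     ((\<Sum>l \<in> UNIV - {j}. (cmod (hprod (h i i j) (column l (W $ i))))\<^sup>2)
      + (\<Sum>m \<in> UNIV - {i}. (norm (hrow (h m i j) (W $ m)))\<^sup>2)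
      + (\<Sum>m \<in> UNIV. Re (hprod (h m i j) (tx_cov \<eta> W m *v h m i j)))
      + rx_variance h \<nu> \<sigma> W i j)"


section \<open>The two problems\<close>

definition P1 ::
  "('c::finite, 'u::finite, 'a::finite) channel \<Rightarrow> (real \<Rightarrow> real) \<Rightarrow> (real \<Rightarrow> real) \<Rightarrow> real \<Rightarrow>
   ('c \<Rightarrow> nat) \<Rightarrow> ('c \<Rightarrow> nat \<Rightarrow> complex^'a^'a) \<Rightarrow> ('c \<Rightarrow> nat \<Rightarrow> real) \<Rightarrow> real \<Rightarrow>
   ('c \<Rightarrow> 'u \<Rightarrow> real \<Rightarrow> real) \<Rightarrow> ('c \<Rightarrow> 'u \<Rightarrow> real) \<Rightarrow>
   (real \<times> ('c, 'u, 'a) beamformers) opt_problem" where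
  "P1 h \<eta> \<nu> \<sigma> L Q q \<delta> g \<gamma> =
     \<lparr> objective = (\<lambda>(\<beta>, W). \<beta>),
       ineqs =
         {(\<lambda>(\<beta>, W). \<gamma> i j - g i j (SINR h \<eta> \<nu> \<sigma> W i j)) | i j. True} \<union>
         {(\<lambda>(\<beta>, W). Re (trace (ctranspose (W $ i) ** Q i k ** (W $ i)))
                    + Re (trace (\<delta> *\<^sub>R (Q i k ** tx_cov \<eta> W i))) - \<beta> * q i k)
            | i k. k \<in> {1..L i}},
       eqs = {} \<rparr>"

text \<open>\<open>qos_fun g c s u\<close> is the function of the constraint
  \<open>s \<le> sqrt (1 + 1 / g\<^sup>-\<^sup>1(c)) * u\<close>, with the inverse of \<open>g\<close> taken on \<open>[0, \<infinity>)\<close>.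
  Two degenerate cases are fixed by the usual conventions instead of the library value \<open>1 / 0 = 0\<close>.
  If the target \<open>c\<close> is not attained by \<open>g\<close>, then \<open>g\<^sup>-\<^sup>1(c) = \<infinity>\<close> and the factor is \<open>1\<close>.
  If \<open>g\<^sup>-\<^sup>1(c) = 0\<close>, the factor is \<open>\<infinity>\<close> and the constraint is the limit \<open>0 \<le> u\<close>, as
  obtained by dividing by the factor.\<close>

definition qos_fun :: "(real \<Rightarrow> real) \<Rightarrow> real \<Rightarrow> real \<Rightarrow> real \<Rightarrow> real" where
  "qos_fun g c s u =
     (if c \<notin> g ` {0..} then s - u
      else if the_inv_into {0..} g c = 0 then - u
      else s - sqrt (1 + 1 / the_inv_into {0..} g c) * u)"

definition P2 ::
  "('c::finite, 'u::finite, 'a::finite) channel \<Rightarrow> (real \<Rightarrow> real) \<Rightarrow> (real \<Rightarrow> real) \<Rightarrow> real \<Rightarrow>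
   ('c \<Rightarrow> nat) \<Rightarrow> ('c \<Rightarrow> nat \<Rightarrow> complex^'a^'a) \<Rightarrow> ('c \<Rightarrow> nat \<Rightarrow> real) \<Rightarrow> real \<Rightarrow>
   ('c \<Rightarrow> 'u \<Rightarrow> real \<Rightarrow> real) \<Rightarrow> ('c \<Rightarrow> 'u \<Rightarrow> real) \<Rightarrow>
   (real \<times> ('c, 'u, 'a) beamformers \<times> (real^'a^'c) \<times> (real^'u^'c)) opt_problem" where
  "P2 h \<eta> \<nu> \<sigma> L Q q \<delta> g \<gamma> =
     \<lparr> objective = (\<lambda>(\<beta>, W, t, r). \<beta>),
       ineqs =
         {(\<lambda>(\<beta>, W, t, r). - (t $ i $ n)) | i n. True} \<union>
         {(\<lambda>(\<beta>, W, t, r). - (r $ i $ j)) | i j. True} \<union>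
         {(\<lambda>(\<beta>, W, t, r).
              Re (trace (ctranspose (W $ i) ** Q i k ** (W $ i)))
              + (\<Sum>n\<in>UNIV. Re (trace (\<delta> *\<^sub>R (Q i k ** T n))) * (t $ i $ n)\<^sup>2) - \<beta> * q i k)
            | i k. k \<in> {1..L i}} \<union>
         {(\<lambda>(\<beta>, W, t, r).
              qos_fun (g i j) (\<gamma> i j)
                (sqrt (rx_power h W i j
                       + (\<Sum>m\<in>UNIV. \<Sum>n\<in>UNIV.
                            Re (hprod (h m i j) (T n *v h m i j)) * (t $ m $ n)\<^sup>2)
                       + (r $ i $ j)\<^sup>2 + \<sigma>\<^sup>2))
                (Re (hprod (h i i j) (column j (W $ i)))))
            | i j. True} \<union>
         {(\<lambda>(\<beta>, W, t, r). \<eta> (norm (T n ** (W $ m))) - t $ m $ n) | m n. True} \<union>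
         {(\<lambda>(\<beta>, W, t, r). \<nu> (sqrt (rx_power h W i j)) - r $ i $ j) | i j. True},
       eqs = {(\<lambda>(\<beta>, W, t, r). Im (hprod (h i i j) (column j (W $ i)))) | i j. True} \<rparr>"

text \<open>Phase rotation of the beamforming vectors, which leaves the constraints of \<open>P1\<close>
  unchanged.\<close>

definition rotate_beams ::
  "('c \<Rightarrow> 'u \<Rightarrow> real) \<Rightarrow> ('c::finite, 'u::finite, 'a::finite) beamformers \<Rightarrow>
   ('c, 'u, 'a) beamformers" where
  "rotate_beams \<theta> W = (\<chi> i n j. cis (\<theta> i j) * W $ i $ n $ j)"

end

(* The phases of the beamformers are irrelevant in the original problem, so each useful signal
   may be assumed real and nonnegative; the SINR constraint then becomes a bound on the square
   root of the total received power by a linear function.  The distortion terms enter only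
   monotonically, so they can be relaxed to slack variables t and r that are tight at no loss.
   The square root of the total power is convex because sqrt (f + g) is convex whenever sqrt f
   and sqrt g are (Minkowski's inequality in the plane). *)

theory Submission imports Defs begin

section \<open>Convex functions\<close>

lemma convex_on_compose_linear:
  assumes "convex_on UNIV f" "linear l"
  shows "convex_on UNIV (\<lambda>x. f (l x))"
  using assms by (auto simp: convex_on_def linear_add linear_scale)

lemma linear_imp_convex_on:
  fixes l :: "'x::real_vector \<Rightarrow> real"
  assumes "linear l"
  shows "convex_on UNIV l"
  using assms by (auto simp: convex_on_def linear_add linear_scale)

lemma convex_on_diff_linear:
  assumes "convex_on UNIV f" "linear l"
  shows "convex_on UNIV (\<lambda>x. f x - l x)"
proof -
  have "convex_on UNIV (\<lambda>x. - l x)"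
    by (rule linear_imp_convex_on[OF linear_compose_neg[OF assms(2)]])
  from convex_on_add[OF assms(1) this] show ?thesis by simp
qed

lemma convex_on_norm_linear:
  assumes "linear l"
  shows "convex_on UNIV (\<lambda>x. norm (l x))"
  using convex_on_compose_linear[OF convex_on_dist[OF convex_UNIV, of 0] assms] by simp

text \<open>Monotonicity carries the convexity bound for \<open>f\<close> into
  \<open>\<phi>\<close>, whose own convexity then splits it. Nonnegativity of \<open>f\<close> keeps
  every argument in \<open>{0..}\<close>, where \<open>\<phi>\<close> is controlled.\<close>

lemma convex_on_mono_compose:
  assumes "convex_on UNIV f" "\<And>x. 0 \<le> f x" "convex_on {0..} \<phi>" "mono_on {0..} (\<phi> :: real \<Rightarrow> real)"
  shows "convex_on UNIV (\<lambda>x. \<phi> (f x))"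
  unfolding convex_on_def
proof (intro conjI ballI allI impI)
  fix x y and u v :: real
  assume uv: "0 \<le> u" "0 \<le> v" "u + v = 1"
  have "f (u *\<^sub>R x + v *\<^sub>R y) \<le> u * f x + v * f y"
    using assms(1) uv by (auto simp: convex_on_def)
  then have "\<phi> (f (u *\<^sub>R x + v *\<^sub>R y)) \<le> \<phi> (u * f x + v * f y)"
    using assms(2) uv by (intro mono_onD[OF assms(4)]) auto
  also have "\<dots> \<le> u * \<phi> (f x) + v * \<phi> (f y)"
    using assms(2,3) uv by (auto simp: convex_on_def)
  finally show "\<phi> (f (u *\<^sub>R x + v *\<^sub>R y)) \<le> u * \<phi> (f x) + v * \<phi> (f y)" .
qed auto

lemma convex_on_sqrt_add:
  fixes f g :: "'x::real_vector \<Rightarrow> real"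
  assumes f: "convex_on UNIV (\<lambda>x. sqrt (f x))" "\<And>x. 0 \<le> f x"
    and g: "convex_on UNIV (\<lambda>x. sqrt (g x))" "\<And>x. 0 \<le> g x"
  shows "convex_on UNIV (\<lambda>x. sqrt (f x + g x))"
  unfolding convex_on_def
proof (intro conjI ballI allI impI)
  fix x y :: 'x and u v :: real
  assume uv: "0 \<le> u" "0 \<le> v" "u + v = 1"
  let ?z = "u *\<^sub>R x + v *\<^sub>R y"
  have "sqrt (f ?z + g ?z) = sqrt ((sqrt (f ?z))\<^sup>2 + (sqrt (g ?z))\<^sup>2)"
    using f(2) g(2) by simp
  also have "\<dots> \<le> sqrt ((u * sqrt (f x) + v * sqrt (f y))\<^sup>2 + (u * sqrt (g x) + v * sqrt (g y))\<^sup>2)"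
    using f g uv by (intro real_sqrt_le_mono add_mono power_mono) (auto simp: convex_on_def)
  \<comment> \<open>Triangle inequality in the plane for the vectors
    \<open>u * (sqrt (f x), sqrt (g x))\<close> and
    \<open>v * (sqrt (f y), sqrt (g y))\<close>.\<close>
  also have "\<dots> \<le> sqrt ((u * sqrt (f x))\<^sup>2 + (u * sqrt (g x))\<^sup>2)
      + sqrt ((v * sqrt (f y))\<^sup>2 + (v * sqrt (g y))\<^sup>2)"
    by (rule real_sqrt_sum_squares_triangle_ineq)
  also have "\<dots> = u * sqrt (f x + g x) + v * sqrt (f y + g y)"
    using f(2) g(2) uv
    by (simp add: power_mult_distrib real_sqrt_mult flip: distrib_left)
  finally show "sqrt (f ?z + g ?z) \<le> u * sqrt (f x + g x) + v * sqrt (f y + g y)" .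
qed auto

lemma convex_on_sum_functions:
  assumes "finite I" "\<And>i. i \<in> I \<Longrightarrow> convex_on UNIV (f i)"
  shows "convex_on UNIV (\<lambda>x. \<Sum>i\<in>I. f i x)"
  using assms
proof (induction I rule: finite_induct)
  case empty
  then show ?case by (simp add: convex_on_def)
next
  case (insert i I)
  then show ?case by (simp add: convex_on_add)
qed

lemma convex_on_sqrt_sum:
  assumes "finite I" "\<And>i. i \<in> I \<Longrightarrow> convex_on UNIV (\<lambda>x. sqrt (f i x))"
    and "\<And>i x. i \<in> I \<Longrightarrow> 0 \<le> f i x"
  shows "convex_on UNIV (\<lambda>x. sqrt (\<Sum>i\<in>I. f i x))"
  using assms
proof (induction I rule: finite_induct)
  case empty
  then show ?case by (simp add: convex_on_def)
next
  case (insert i I)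
  then show ?case
    by (simp add: convex_on_sqrt_add sum_nonneg)
qed

text \<open>The square root equals \<open>sqrt c * \<bar>l x\<bar>\<close>, a nonnegative multiple
  of the norm of a linear map.\<close>

lemma convex_on_sqrt_scaled_square:
  fixes l :: "'x::real_vector \<Rightarrow> real"
  assumes "linear l" "0 \<le> c"
  shows "convex_on UNIV (\<lambda>x. sqrt (c * (l x)\<^sup>2))"
  using convex_on_cmul[OF _ convex_on_norm_linear[OF assms(1)], of "sqrt c"] assms(2)
  by (simp add: real_sqrt_mult)

text \<open>The convexity defect is exactly \<open>u * v * B (x - y) (x - y)\<close>, hence
  nonnegative.\<close>

lemma convex_on_bilinear_form:
  assumes "bilinear B" "\<And>x. 0 \<le> (B x x :: real)"
  shows "convex_on UNIV (\<lambda>x. B x x)"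
  unfolding convex_on_def
proof (intro conjI ballI allI impI)
  fix x y and u v :: real
  assume uv: "0 \<le> u" "0 \<le> v" "u + v = 1"
  have v: "v = 1 - u" using uv by simp
  have "u * B x x + v * B y y - B (u *\<^sub>R x + v *\<^sub>R y) (u *\<^sub>R x + v *\<^sub>R y)
      = u * v * B (x - y) (x - y)"
    by (simp add: v assms(1) bilinear_ladd bilinear_radd bilinear_lmul bilinear_rmul
        bilinear_lsub bilinear_rsub algebra_simps)
  also have "\<dots> \<ge> 0" using uv assms(2) by simp
  finally show "B (u *\<^sub>R x + v *\<^sub>R y) (u *\<^sub>R x + v *\<^sub>R y) \<le> u * B x x + v * B y y" by simp
qed auto

section \<open>Hermitian products and traces\<close>

lemma linear_hprod_column: "linear (\<lambda>V. hprod x (column j V))"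
  by (rule linearI) (simp_all add: hprod_def column_def algebra_simps sum.distrib scaleR_sum_right)

lemma linear_hrow: "linear (hrow x)"
proof (rule linearI)
  show "hrow x (V + V') = hrow x V + hrow x V'" for V V'
    by (simp add: hrow_def vec_eq_iff linear_add[OF linear_hprod_column])
  show "hrow x (c *\<^sub>R V) = c *\<^sub>R hrow x V" for c V
    by (simp add: hrow_def vec_eq_iff linear_scale[OF linear_hprod_column])
qed

lemma norm_hrow_sq: "(norm (hrow x V))\<^sup>2 = (\<Sum>l\<in>UNIV. (cmod (hprod x (column l V)))\<^sup>2)"
  by (simp add: norm_vec_def L2_set_def hrow_def sum_nonneg)

lemma T_mult_nth: "(T n ** V) $ a $ l = (if a = n then V $ n $ l else 0)"
  by (simp add: matrix_matrix_mult_def T_def mult_delta_left)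

lemma linear_T_mult: "linear (\<lambda>V. T n ** V)"
  by (rule linearI) (simp_all add: vec_eq_iff T_mult_nth)

lemma hprod_T: "hprod x (T n *v x) = of_real ((cmod (x $ n))\<^sup>2)"
proof -
  have "(T n *v x) $ a = (if a = n then x $ n else 0)" for a
    by (simp add: matrix_vector_mult_def T_def mult_delta_left)
  then have "hprod x (T n *v x) = cnj (x $ n) * x $ n"
    by (simp add: hprod_def mult_delta_right)
  also have "\<dots> = of_real ((cmod (x $ n))\<^sup>2)"
    by (simp only: complex_norm_square mult.commute)
  finally show ?thesis .
qed

text \<open>The covariance is the sum of the \<open>T n\<close> weighted by the squared distortions.
  The distortion term thus has the shape it has in \<open>P2\<close>, with the distortion magnitudes
  in place of \<open>t\<close>.\<close>

lemma hprod_tx_cov: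
  "Re (hprod x (tx_cov \<eta> W m *v x))
    = (\<Sum>n\<in>UNIV. Re (hprod x (T n *v x)) * (tx_distortion \<eta> W m n)\<^sup>2)"
proof -
  have "(tx_cov \<eta> W m *v x) $ a = of_real ((tx_distortion \<eta> W m a)\<^sup>2) * x $ a" for a
    by (simp add: matrix_vector_mult_def tx_cov_def mult_delta_left)
  then have "hprod x (tx_cov \<eta> W m *v x)
      = (\<Sum>a\<in>UNIV. of_real ((cmod (x $ a))\<^sup>2 * (tx_distortion \<eta> W m a)\<^sup>2))"
    unfolding hprod_def by (simp add: complex_norm_square mult_ac del: of_real_power)
  then show ?thesis by (simp add: hprod_T)
qed

lemma trace_mult_T: "trace (A ** T n) = A $ n $ n"
proof -
  have "(A ** T n) $ i $ i = (if i = n then A $ n $ n else 0)" for i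
    by (cases "i = n") (simp_all add: matrix_matrix_mult_def T_def mult_delta_right)
  then show ?thesis by (simp add: trace_def)
qed

lemma trace_scaleR: "trace (c *\<^sub>R A) = c *\<^sub>R trace (A :: complex^'n^'n)"
  by (simp add: trace_def scaleR_sum_right)

lemma trace_mult_tx_cov:
  "Re (trace (\<delta> *\<^sub>R (A ** tx_cov \<eta> W i)))
    = (\<Sum>n\<in>UNIV. Re (trace (\<delta> *\<^sub>R (A ** T n))) * (tx_distortion \<eta> W i n)\<^sup>2)"
proof -
  have "trace (A ** tx_cov \<eta> W i)
      = (\<Sum>a\<in>UNIV. A $ a $ a * of_real ((tx_distortion \<eta> W i a)\<^sup>2))"
    by (simp add: trace_def matrix_matrix_mult_def tx_cov_def mult_delta_right)
  then show ?thesis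
    by (simp add: trace_scaleR trace_mult_T sum_distrib_left mult_ac flip: of_real_power)
qed

text \<open>A diagonal entry is the quadratic form at a unit vector. This makes the weights of the
  squared slacks in the power constraints nonnegative.\<close>

lemma psd_diag_nonneg:
  assumes "psd A"
  shows "0 \<le> Re (A $ n $ n)"
proof -
  have "hprod (axis n 1) (A *v axis n 1) = A $ n $ n"
    by (simp add: hprod_def matrix_vector_mult_def axis_def if_distrib[of cnj]
        mult_delta_left mult_delta_right cong: if_cong)
  then show ?thesis using assms unfolding psd_def by metis
qed

text \<open>Splitting the beamforming power into one quadratic form per column gives both its
  nonnegativity and its invariance under phase rotation.\<close>

lemma trace_quadratic:
  "trace (ctranspose V ** A ** V) = (\<Sum>l\<in>UNIV. hprod (column l V) (A *v column l V))"
proof -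
  have "trace (ctranspose V ** (A ** V)) = (\<Sum>l\<in>UNIV. hprod (column l V) (A *v column l V))"
    by (simp add: trace_def hprod_def ctranspose_def matrix_matrix_mult_def matrix_vector_mult_def
        column_def)
  then show ?thesis by (simp add: matrix_mul_assoc)
qed

lemma convex_on_trace_quadratic:
  assumes "psd A"
  shows "convex_on UNIV (\<lambda>V :: complex^'u^'a. Re (trace (ctranspose V ** A ** V)))"
\<comment> \<open>Conjugation in the first argument is linear over the reals, so the form is real
  bilinear.\<close>
proof (rule convex_on_bilinear_form[where B = "\<lambda>V V'. Re (trace (ctranspose V ** A ** V'))"])
  show "bilinear (\<lambda>V V' :: complex^'u^'a. Re (trace (ctranspose V ** A ** V')))"
    unfolding bilinear_def
    by (intro conjI allI linearI; simp add: trace_def ctranspose_def matrix_matrix_mult_def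
        algebra_simps sum.distrib sum_distrib_left)
  show "0 \<le> Re (trace (ctranspose V ** A ** V))" for V :: "complex^'u^'a"
    using assms by (simp add: trace_quadratic psd_def sum_nonneg)
qed

section \<open>Received power and SINR\<close>

lemma rx_power_nonneg: "0 \<le> rx_power h W i j"
  by (simp add: rx_power_def sum_nonneg)

text \<open>The radicand of the quality-of-service constraint in \<open>P2\<close>. At tight slacks
  it is the SINR denominator plus the useful signal power.\<close>

definition total_power ::
  "('c::finite, 'u::finite, 'a::finite) channel \<Rightarrow> real \<Rightarrow> ('c, 'u, 'a) beamformers \<Rightarrow>
   (real^'a^'c) \<Rightarrow> (real^'u^'c) \<Rightarrow> 'c \<Rightarrow> 'u \<Rightarrow> real" where
  "total_power h \<sigma> W t r i j =
     rx_power h W i j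
     + (\<Sum>m\<in>UNIV. \<Sum>n\<in>UNIV. Re (hprod (h m i j) (T n *v h m i j)) * (t $ m $ n)\<^sup>2)
     + (r $ i $ j)\<^sup>2 + \<sigma>\<^sup>2"

lemma total_power_mono:
  assumes "\<And>m n. 0 \<le> t $ m $ n" "\<And>m n. t $ m $ n \<le> t' $ m $ n"
    and "0 \<le> r $ i $ j" "r $ i $ j \<le> r' $ i $ j"
  shows "total_power h \<sigma> W t r i j \<le> total_power h \<sigma> W t' r' i j"
  unfolding total_power_def
  using assms by (intro add_mono order_refl sum_mono mult_left_mono power_mono) (auto simp: hprod_T)

text \<open>The smallest \<open>t\<close> that the distortion constraints of \<open>P2\<close>
  allow; \<open>rx_slack\<close> plays the same part for \<open>r\<close>.\<close>

definition tx_slack :: "(real \<Rightarrow> real) \<Rightarrow> ('c::finite, 'u::finite, 'a::finite) beamformers \<Rightarrow> real^'a^'c"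
  where "tx_slack \<eta> W = (\<chi> m n. tx_distortion \<eta> W m n)"

definition rx_slack ::
  "('c::finite, 'u::finite, 'a::finite) channel \<Rightarrow> (real \<Rightarrow> real) \<Rightarrow>
   ('c, 'u, 'a) beamformers \<Rightarrow> real^'u^'c"
  where "rx_slack h \<nu> W = (\<chi> i j. \<nu> (sqrt (rx_power h W i j)))"

text \<open>The useful signal is one summand of the received power, and positive noise makes the
  bound strict. The SINR denominator is therefore positive and can be multiplied out.\<close>

lemma signal_less_total_power:
  assumes "0 < \<sigma>"
  shows "(cmod (hprod (h i i j) (column j (W $ i))))\<^sup>2 < total_power h \<sigma> W t r i j"
proof -
  have "(cmod (hprod (h i i j) (column j (W $ i))))\<^sup>2 \<le> (norm (hrow (h i i j) (W $ i)))\<^sup>2"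
    unfolding norm_hrow_sq
    by (rule member_le_sum[of j UNIV "\<lambda>l. (cmod (hprod (h i i j) (column l (W $ i))))\<^sup>2"]) auto
  also have "\<dots> \<le> rx_power h W i j"
    unfolding rx_power_def
    by (rule member_le_sum[of i UNIV "\<lambda>m. (norm (hrow (h m i j) (W $ m)))\<^sup>2"]) auto
  also have "\<dots> < rx_power h W i j + \<sigma>\<^sup>2" using assms by simp
  also have "\<dots> \<le> total_power h \<sigma> W t r i j"
    by (simp add: total_power_def hprod_T sum_nonneg)
  finally show ?thesis .
qed

text \<open>The first interference sum lacks only the useful signal and the second only the own
  cell, so together they are the full received power minus the useful power.\<close>

lemma SINR_eq:
  fixes h :: "('c::finite, 'u::finite, 'a::finite) channel"
  defines "p \<equiv> \<lambda>W i j. (cmod (hprod (h i i j) (column j (W $ i))))\<^sup>2"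
  shows "SINR h \<eta> \<nu> \<sigma> W i j
    = p W i j / (total_power h \<sigma> W (tx_slack \<eta> W) (rx_slack h \<nu> W) i j - p W i j)"
proof -
  have "(\<Sum>l\<in>UNIV - {j}. (cmod (hprod (h i i j) (column l (W $ i))))\<^sup>2)
      = (norm (hrow (h i i j) (W $ i)))\<^sup>2 - p W i j"
    by (simp add: norm_hrow_sq p_def sum_diff1)
  moreover have "(\<Sum>m\<in>UNIV - {i}. (norm (hrow (h m i j) (W $ m)))\<^sup>2)
      = rx_power h W i j - (norm (hrow (h i i j) (W $ i)))\<^sup>2"
    by (simp add: rx_power_def sum_diff1)
  ultimately show ?thesis
    by (simp add: SINR_def total_power_def tx_slack_def rx_slack_def rx_variance_def
        hprod_tx_cov p_def algebra_simps)
qed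

section \<open>Inverting the performance function in the quality-of-service constraint\<close>

lemma continuous_strict_mono_image:
  assumes "strict_mono_on {0..} (g :: real \<Rightarrow> real)" "continuous_on {0..} g" "g 0 = 0"
    and "0 \<le> c" "0 \<le> x" "c \<le> g x"
  shows "c \<in> g ` {0..}"
proof -
  have "continuous_on {0..x} g" using assms(2) continuous_on_subset by fastforce
  then obtain y where "0 \<le> y" "g y = c" using IVT'[of g 0 c x] assms by auto
  then show ?thesis by auto
qed

lemma qos_fun_mono:
  assumes "strict_mono_on {0..} g" "s \<le> s'" "u' \<le> u"
  shows "qos_fun g c s u \<le> qos_fun g c s' u'"
proof (cases "c \<in> g ` {0..}")
  case True
  have inj: "inj_on g {0..}" using assms(1) by (rule strict_mono_on_imp_inj_on)
  \<comment> \<open>With a nonnegative inverse the factor in front of \<open>u\<close> is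
    nonnegative, so enlarging \<open>u\<close> can only lower the value.\<close>
  have "0 \<le> the_inv_into {0..} g c"
    using the_inv_into_into[OF inj True subset_refl] by simp
  then show ?thesis
    using assms(2,3) by (auto simp: qos_fun_def intro!: diff_mono mult_left_mono)
next
  case False
  then show ?thesis using assms by (simp add: qos_fun_def)
qed

text \<open>With signal amplitude \<open>u\<close> and total received power \<open>S\<close>, \<open>u\<^sup>2 / (S - u\<^sup>2) \<ge> x\<close> means
  \<open>S \<le> (1 + 1 / x) u\<^sup>2\<close>, and both sides admit square roots.\<close>

lemma qos_fun_iff:
  fixes g :: "real \<Rightarrow> real"
  assumes g: "strict_mono_on {0..} g" "continuous_on {0..} g" "g 0 = 0"
    and c: "0 \<le> c" and u: "0 \<le> u" "u\<^sup>2 < S"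
  shows "qos_fun g c (sqrt S) u \<le> 0 \<longleftrightarrow> c \<le> g (u\<^sup>2 / (S - u\<^sup>2))"
proof (cases "c \<in> g ` {0..}")
  case True
  then obtain x where x: "0 \<le> x" "g x = c" by auto
  have inv: "the_inv_into {0..} g c = x"
    using x the_inv_into_f_f[OF strict_mono_on_imp_inj_on[OF g(1)], of x] by auto
  have y: "0 \<le> u\<^sup>2 / (S - u\<^sup>2)" using u by simp
  have "c \<le> g (u\<^sup>2 / (S - u\<^sup>2)) \<longleftrightarrow> x \<le> u\<^sup>2 / (S - u\<^sup>2)"
    using x y strict_mono_on_leD[OF g(1)] strict_mono_onD[OF g(1)]
    by (metis atLeast_iff linorder_not_less)
  also have "\<dots> \<longleftrightarrow> qos_fun g c (sqrt S) u \<le> 0"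
  proof (cases "x = 0")
    \<comment> \<open>A zero target holds on both sides: the SINR is nonnegative, and the limiting
      constraint reads \<open>- u \<le> 0\<close>.\<close>
    case True
    then show ?thesis using y u inv \<open>c \<in> g ` {0..}\<close> by (simp add: qos_fun_def)
  next
    case False
    then have "0 < x" using x by simp
    have "x \<le> u\<^sup>2 / (S - u\<^sup>2) \<longleftrightarrow> S \<le> (1 + 1 / x) * u\<^sup>2"
      using u \<open>0 < x\<close> by (simp add: field_simps)
    also have "\<dots> \<longleftrightarrow> sqrt S \<le> sqrt (1 + 1 / x) * u"
      using u(1) by (metis real_sqrt_le_iff real_sqrt_mult real_sqrt_unique)
    finally show ?thesis using False inv \<open>c \<in> g ` {0..}\<close> by (simp add: qos_fun_def)
  qed
  finally show ?thesis by simp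
next
  case False
  \<comment> \<open>For an unattained target both sides fail: the constraint with factor 1
    contradicts \<open>u\<^sup>2 < S\<close>, and by the intermediate value theorem \<open>c\<close>
    exceeds every value of \<open>g\<close> on \<open>{0..}\<close>.\<close>
  have "u < sqrt S" using u by (simp add: real_less_rsqrt)
  moreover have "\<not> c \<le> g (u\<^sup>2 / (S - u\<^sup>2))"
    using continuous_strict_mono_image[OF g c, of "u\<^sup>2 / (S - u\<^sup>2)"] False u by auto
  ultimately show ?thesis using False by (simp add: qos_fun_def)
qed

text \<open>Using the modulus of the useful signal makes the equivalence valid before any phase is
  normalized.\<close>

lemma qos_iff_SINR:
  fixes g :: "real \<Rightarrow> real"
  assumes "strict_mono_on {0..} g" "continuous_on {0..} g" "g 0 = 0" "0 \<le> c" "0 < \<sigma>"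
  shows "qos_fun g c (sqrt (total_power h \<sigma> W (tx_slack \<eta> W) (rx_slack h \<nu> W) i j))
      (cmod (hprod (h i i j) (column j (W $ i)))) \<le> 0 \<longleftrightarrow> c \<le> g (SINR h \<eta> \<nu> \<sigma> W i j)"
  unfolding SINR_eq using assms signal_less_total_power by (intro qos_fun_iff) auto

section \<open>Phase rotation\<close>

lemma hprod_column_rotate:
  "hprod x (column j (rotate_beams \<theta> W $ i)) = cis (\<theta> i j) * hprod x (column j (W $ i))"
  by (simp add: hprod_def rotate_beams_def column_def sum_distrib_left mult_ac)

lemma norm_hrow_rotate: "norm (hrow x (rotate_beams \<theta> W $ i)) = norm (hrow x (W $ i))"
  by (simp add: norm_vec_def hrow_def hprod_column_rotate norm_mult)

lemma rx_power_rotate: "rx_power h (rotate_beams \<theta> W) = rx_power h W"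
  by (simp add: rx_power_def norm_hrow_rotate fun_eq_iff)

text \<open>\<open>T n\<close> keeps row \<open>n\<close> alone, and rotation changes no entry in
  modulus.\<close>

lemma norm_T_mult_rotate: "norm (T n ** (rotate_beams \<theta> W $ i)) = norm (T n ** (W $ i))"
proof -
  have "norm ((T n ** (rotate_beams \<theta> W $ i)) $ a) = norm ((T n ** (W $ i)) $ a)" for a
    unfolding norm_vec_def[of "_ $ a"]
    by (intro L2_set_cong) (auto simp: T_mult_nth rotate_beams_def norm_mult)
  then show ?thesis by (simp add: norm_vec_def[of "_ ** _"])
qed

lemma slack_rotate:
  "tx_slack \<eta> (rotate_beams \<theta> W) = tx_slack \<eta> W"
  "rx_slack h \<nu> (rotate_beams \<theta> W) = rx_slack h \<nu> W"
  by (simp_all add: tx_slack_def tx_distortion_def rx_slack_def norm_T_mult_rotate rx_power_rotate)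

lemma total_power_rotate: "total_power h \<sigma> (rotate_beams \<theta> W) t r = total_power h \<sigma> W t r"
  by (simp add: total_power_def rx_power_rotate fun_eq_iff)

lemma trace_quadratic_rotate:
  "trace (ctranspose (rotate_beams \<theta> W $ i) ** A ** (rotate_beams \<theta> W $ i))
    = trace (ctranspose (W $ i) ** A ** (W $ i))"
proof -
  have col: "column l (rotate_beams \<theta> W $ i) = cis (\<theta> i l) *s column l (W $ i)" for l
    by (simp add: vec_eq_iff column_def rotate_beams_def)
  \<comment> \<open>A scalar factor leaves the quadratic form multiplied by its squared modulus,
    which is 1 for \<open>cis\<close>.\<close>
  have "hprod (c *s x) (A *v (c *s x)) = of_real ((cmod c)\<^sup>2) * hprod x (A *v x)" for c x
    by (simp add: hprod_def vector_scalar_commute complex_norm_square sum_distrib_left mult_ac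
        del: of_real_power)
  then show ?thesis
    unfolding trace_quadratic col by simp
qed

section \<open>Convexity of the second problem\<close>

type_synonym ('c, 'u, 'a) point =
  "real \<times> ('c, 'u, 'a) beamformers \<times> (real^'a^'c) \<times> (real^'u^'c)"

lemma convex_on_sqrt_rx_power: "convex_on UNIV (\<lambda>W. sqrt (rx_power h W i j))"
  unfolding rx_power_def
proof (intro convex_on_sqrt_sum)
  fix m
  have "linear (\<lambda>W. hrow (h m i j) (W $ m))"
    by (rule linearI) (simp_all add: linear_add[OF linear_hrow] linear_scale[OF linear_hrow])
  from convex_on_norm_linear[OF this]
  show "convex_on UNIV (\<lambda>W. sqrt ((norm (hrow (h m i j) (W $ m)))\<^sup>2))" by simp
qed auto

text \<open>Each summand has a convex square root: a norm of a linear map, a multiple of the modulus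
  of a coordinate, or a constant. Repeated use of \<open>convex_on_sqrt_add\<close> combines
  them.\<close>

lemma convex_on_sqrt_total_power:
  fixes h :: "('c::finite, 'u::finite, 'a::finite) channel"
  shows "convex_on UNIV
    (\<lambda>x :: ('c, 'u, 'a) point.
      sqrt (total_power h \<sigma> (fst (snd x)) (fst (snd (snd x))) (snd (snd (snd x))) i j))"
  unfolding total_power_def
proof (intro convex_on_sqrt_add convex_on_sqrt_sum convex_on_sqrt_scaled_square add_nonneg_nonneg
    sum_nonneg)
  show "convex_on UNIV
      (\<lambda>x :: ('c, 'u, 'a) point.
        sqrt (rx_power h (fst (snd x)) i j))"
    by (rule convex_on_compose_linear[OF convex_on_sqrt_rx_power]) (rule linearI; simp)
  show "convex_on UNIV
      (\<lambda>x :: ('c, 'u, 'a) point.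
        sqrt ((snd (snd (snd x)) $ i $ j)\<^sup>2))"
    using convex_on_sqrt_scaled_square[of
        "\<lambda>x :: ('c, 'u, 'a) point. snd (snd (snd x)) $ i $ j" 1]
    by (simp add: linearI)
qed (auto simp: rx_power_nonneg hprod_T convex_on_def simp flip: distrib_right intro!: linearI)

text \<open>The case distinction depends on \<open>g\<close> and \<open>c\<close> but not on
  \<open>x\<close>, so a single branch applies throughout, and each branch is linear or convex minus
  linear.\<close>

lemma convex_on_qos_fun:
  assumes "convex_on UNIV s" "linear u"
  shows "convex_on UNIV (\<lambda>x. qos_fun g c (s x) (u x))"
proof -
  have "linear (\<lambda>x. k * u x)" for k
    using assms(2) by (intro linearI) (simp_all add: linear_add linear_scale algebra_simps)
  from convex_on_diff_linear[OF assms(1) this] convex_on_diff_linear[OF assms]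
    linear_imp_convex_on[OF linear_compose_neg[OF assms(2)]]
  show ?thesis
    by (cases "c \<in> g ` {0..}"; cases "the_inv_into {0..} g c = 0") (simp_all add: qos_fun_def)
qed

lemma convex_on_power_constraint:
  fixes A :: "complex^'a::finite^'a" and i :: "'c::finite"
  assumes "psd A" "0 \<le> \<delta>"
  shows "convex_on UNIV
    (\<lambda>x :: ('c, 'u::finite, 'a) point.
      Re (trace (ctranspose (fst (snd x) $ i) ** A ** (fst (snd x) $ i)))
      + (\<Sum>n\<in>UNIV. Re (trace (\<delta> *\<^sub>R (A ** T n))) * (fst (snd (snd x)) $ i $ n)\<^sup>2) - fst x * b)"
proof (intro convex_on_diff_linear convex_on_add convex_on_sum_functions)
  show "convex_on UNIV
    (\<lambda>x :: ('c, 'u, 'a) point.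
      Re (trace (ctranspose (fst (snd x) $ i) ** A ** (fst (snd x) $ i))))"
    by (rule convex_on_compose_linear[OF convex_on_trace_quadratic[OF assms(1)]])
      (rule linearI; simp)
  have "convex_on UNIV
    (\<lambda>x :: ('c, 'u, 'a) point.
      (fst (snd (snd x)) $ i $ n)\<^sup>2)" for n
    by (rule convex_on_compose_linear[OF convex_power2]) (rule linearI; simp)
  then show "convex_on UNIV
    (\<lambda>x :: ('c, 'u, 'a) point.
      Re (trace (\<delta> *\<^sub>R (A ** T n))) * (fst (snd (snd x)) $ i $ n)\<^sup>2)" for n
    using assms by (intro convex_on_cmul) (simp_all add: trace_scaleR trace_mult_T psd_diag_nonneg)
qed (auto intro: linearI simp: algebra_simps)

lemma ball_family: "(\<forall>f\<in>{F i j | i j. R i j}. S f) \<longleftrightarrow> (\<forall>i j. R i j \<longrightarrow> S (F i j))"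
  by blast

text \<open>Convexity and monotonicity of \<open>\<eta>\<close> and \<open>\<nu>\<close> enter
  through the last two families of inequalities, where they are composed with convex nonnegative
  functions of the beamformers.\<close>

lemma convex_problem_P2:
  fixes h :: "('c::finite, 'u::finite, 'a::finite) channel"
  assumes eta: "mono_on {0..} \<eta>" "convex_on {0..} \<eta>"
    and nu: "mono_on {0..} \<nu>" "convex_on {0..} \<nu>"
    and delta: "0 \<le> \<delta>"
    and Q: "\<And>i k. k \<in> {1..L i} \<Longrightarrow> psd (Q i k)"
  shows "convex_problem (P2 h \<eta> \<nu> \<sigma> L Q q \<delta> g \<gamma>)"
proof -
  have tx: "convex_on UNIV
      (\<lambda>x :: ('c, 'u, 'a) point.
        \<eta> (norm (T n ** (fst (snd x) $ m))) - fst (snd (snd x)) $ m $ n)" for m n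
  proof (intro convex_on_diff_linear convex_on_mono_compose[OF _ _ eta(2,1)] convex_on_norm_linear)
    show "linear (\<lambda>x :: ('c, 'u, 'a) point.
        T n ** (fst (snd x) $ m))"
      by (rule linearI) (simp_all add: linear_add[OF linear_T_mult] linear_scale[OF linear_T_mult])
  qed (auto intro: linearI)
  have rx: "convex_on UNIV
      (\<lambda>x :: ('c, 'u, 'a) point.
        \<nu> (sqrt (rx_power h (fst (snd x)) i j)) - snd (snd (snd x)) $ i $ j)" for i j
    by (intro convex_on_diff_linear convex_on_mono_compose[OF _ _ nu(2,1)]
        convex_on_compose_linear[OF convex_on_sqrt_rx_power])
      (auto simp: rx_power_nonneg intro: linearI)
  note lin_hp = linear_add[OF linear_hprod_column] linear_scale[OF linear_hprod_column]
  have re: "linear (\<lambda>x :: ('c, 'u, 'a) point.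
        Re (hprod (h i i j) (column j (fst (snd x) $ i))))" for i j
    by (rule linearI) (simp_all add: lin_hp)
  have im: "linear (\<lambda>x :: ('c, 'u, 'a) point.
        Im (hprod (h i i j) (column j (fst (snd x) $ i))))" for i j
    by (rule linearI) (simp_all add: lin_hp)
  note qos = convex_on_qos_fun[OF convex_on_sqrt_total_power re, unfolded total_power_def]
  have neg_t: "convex_on UNIV (\<lambda>x :: ('c, 'u, 'a) point.
        - (fst (snd (snd x)) $ i $ n))" for i n
    by (rule linear_imp_convex_on, rule linearI) simp_all
  have neg_r: "convex_on UNIV (\<lambda>x :: ('c, 'u, 'a) point.
        - (snd (snd (snd x)) $ i $ j))" for i j
    by (rule linear_imp_convex_on, rule linearI) simp_all
  have obj: "convex_on UNIV (\<lambda>x :: ('c, 'u, 'a) point. fst x)"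
    by (rule linear_imp_convex_on[OF linear_fst])
  have aff: "affine_fun l" if "linear l"
    for l :: "('c, 'u, 'a) point \<Rightarrow> real"
    using that unfolding affine_fun_def by (intro exI[of _ l] exI[of _ 0]) simp
  show ?thesis
    \<comment> \<open>\<open>case_prod_unfold\<close> turns the tuple patterns into the projections
      used in the facts above; the rules then follow the order of the constraints in
      \<open>P2\<close>.\<close>
    unfolding convex_problem_def P2_def opt_problem.simps case_prod_unfold
      ball_Un ball_family
    by (intro conjI allI impI)
      (rule obj, rule neg_t, rule neg_r, erule convex_on_power_constraint[OF Q delta],
       rule qos, rule tx, rule rx, rule aff[OF im])
qed

section \<open>Equivalence\<close>

text \<open>Written with \<open>tx_slack\<close>, the power constraints become those of
  \<open>P2\<close> at tight \<open>t\<close>.\<close>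

lemma mem_feasible_P1:
  "(\<beta>, W) \<in> feasible (P1 h \<eta> \<nu> \<sigma> L Q q \<delta> g \<gamma>) \<longleftrightarrow>
    (\<forall>i j. \<gamma> i j \<le> g i j (SINR h \<eta> \<nu> \<sigma> W i j)) \<and>
    (\<forall>i. \<forall>k\<in>{1..L i}. Re (trace (ctranspose (W $ i) ** Q i k ** (W $ i)))
       + (\<Sum>n\<in>UNIV. Re (trace (\<delta> *\<^sub>R (Q i k ** T n))) * (tx_slack \<eta> W $ i $ n)\<^sup>2) \<le> \<beta> * q i k)"
  unfolding feasible_def P1_def trace_mult_tx_cov opt_problem.simps mem_Collect_eq
    ball_Un ball_family tx_slack_def
  by auto

lemma mem_feasible_P2:
  "(\<beta>, W, t, r) \<in> feasible (P2 h \<eta> \<nu> \<sigma> L Q q \<delta> g \<gamma>) \<longleftrightarrow>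
    (\<forall>i n. 0 \<le> t $ i $ n) \<and> (\<forall>i j. 0 \<le> r $ i $ j) \<and>
    (\<forall>i j. Im (hprod (h i i j) (column j (W $ i))) = 0) \<and>
    (\<forall>i. \<forall>k\<in>{1..L i}. Re (trace (ctranspose (W $ i) ** Q i k ** (W $ i)))
       + (\<Sum>n\<in>UNIV. Re (trace (\<delta> *\<^sub>R (Q i k ** T n))) * (t $ i $ n)\<^sup>2) \<le> \<beta> * q i k) \<and>
    (\<forall>i j. qos_fun (g i j) (\<gamma> i j) (sqrt (total_power h \<sigma> W t r i j))
       (Re (hprod (h i i j) (column j (W $ i)))) \<le> 0) \<and>
    (\<forall>m n. tx_slack \<eta> W $ m $ n \<le> t $ m $ n) \<and>
    (\<forall>i j. rx_slack h \<nu> W $ i $ j \<le> r $ i $ j)"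
  unfolding feasible_def P2_def opt_problem.simps mem_Collect_eq
    ball_Un ball_family tx_slack_def rx_slack_def tx_distortion_def
  by (auto simp: total_power_def)

text \<open>Lowering the slacks to their tight values and replacing the real part of the useful
  signal by its modulus preserves the quality-of-service and power constraints. The tight form is
  the SINR constraint.\<close>

lemma feasible_P2_imp_P1:
  assumes eta: "\<And>x. 0 \<le> x \<Longrightarrow> 0 \<le> \<eta> x" and nu: "\<And>x. 0 \<le> x \<Longrightarrow> 0 \<le> \<nu> x"
    and noise: "0 < \<sigma>" and delta: "0 \<le> \<delta>"
    and Q: "\<And>i k. k \<in> {1..L i} \<Longrightarrow> psd (Q i k)"
    and g: "\<And>i j. strict_mono_on {0..} (g i j)" "\<And>i j. continuous_on {0..} (g i j)"
      "\<And>i j. g i j 0 = 0"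
    and targets: "\<And>i j. 0 \<le> \<gamma> i j"
    and feas: "(\<beta>, W, t, r) \<in> feasible (P2 h \<eta> \<nu> \<sigma> L Q q \<delta> g \<gamma>)"
  shows "(\<beta>, W) \<in> feasible (P1 h \<eta> \<nu> \<sigma> L Q q \<delta> g \<gamma>)"
  unfolding mem_feasible_P1
proof (intro conjI allI ballI)
  note f = feas[unfolded mem_feasible_P2]
  have slack: "0 \<le> tx_slack \<eta> W $ m $ n" "0 \<le> rx_slack h \<nu> W $ i $ j" for m n i j
    by (simp_all add: tx_slack_def tx_distortion_def rx_slack_def eta nu rx_power_nonneg)
  fix i
  show "\<gamma> i j \<le> g i j (SINR h \<eta> \<nu> \<sigma> W i j)" for j
  proof -
    have "qos_fun (g i j) (\<gamma> i j) (sqrt (total_power h \<sigma> W (tx_slack \<eta> W) (rx_slack h \<nu> W) i j))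
        (cmod (hprod (h i i j) (column j (W $ i))))
      \<le> qos_fun (g i j) (\<gamma> i j) (sqrt (total_power h \<sigma> W t r i j))
        (Re (hprod (h i i j) (column j (W $ i))))"
      using f slack
      by (intro qos_fun_mono g(1) real_sqrt_le_mono total_power_mono complex_Re_le_cmod) auto
    also have "\<dots> \<le> 0" using f by blast
    finally show ?thesis using g noise targets by (simp add: qos_iff_SINR)
  qed
  fix k assume k: "k \<in> {1..L i}"
  have "(\<Sum>n\<in>UNIV. Re (trace (\<delta> *\<^sub>R (Q i k ** T n))) * (tx_slack \<eta> W $ i $ n)\<^sup>2)
      \<le> (\<Sum>n\<in>UNIV. Re (trace (\<delta> *\<^sub>R (Q i k ** T n))) * (t $ i $ n)\<^sup>2)"
  proof (intro sum_mono mult_left_mono power_mono slack)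
    show "tx_slack \<eta> W $ i $ n \<le> t $ i $ n" for n using f by blast
    show "0 \<le> Re (trace (\<delta> *\<^sub>R (Q i k ** T n)))" for n
      using delta psd_diag_nonneg[OF Q[OF k]] by (simp add: trace_scaleR trace_mult_T)
  qed
  moreover have "Re (trace (ctranspose (W $ i) ** Q i k ** (W $ i)))
      + (\<Sum>n\<in>UNIV. Re (trace (\<delta> *\<^sub>R (Q i k ** T n))) * (t $ i $ n)\<^sup>2) \<le> \<beta> * q i k"
    using f k by blast
  ultimately show "Re (trace (ctranspose (W $ i) ** Q i k ** (W $ i)))
      + (\<Sum>n\<in>UNIV. Re (trace (\<delta> *\<^sub>R (Q i k ** T n))) * (tx_slack \<eta> W $ i $ n)\<^sup>2) \<le> \<beta> * q i k"
    by linarith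
qed

text \<open>Rotating each beamformer by minus the phase of its useful signal makes that signal real and
  nonnegative, so its real part equals its modulus; \<open>t\<close> and \<open>r\<close> are taken tight.\<close>

lemma feasible_P1_imp_P2:
  fixes h :: "('c::finite, 'u::finite, 'a::finite) channel" and W :: "('c, 'u, 'a) beamformers"
  assumes eta: "\<And>x. 0 \<le> x \<Longrightarrow> 0 \<le> \<eta> x" and nu: "\<And>x. 0 \<le> x \<Longrightarrow> 0 \<le> \<nu> x"
    and noise: "0 < \<sigma>"
    and g: "\<And>i j. strict_mono_on {0..} (g i j)" "\<And>i j. continuous_on {0..} (g i j)"
      "\<And>i j. g i j 0 = 0"
    and targets: "\<And>i j. 0 \<le> \<gamma> i j"
    and feas: "(\<beta>, W) \<in> feasible (P1 h \<eta> \<nu> \<sigma> L Q q \<delta> g \<gamma>)"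
  defines "\<theta> \<equiv> \<lambda>i j. - Arg (hprod (h i i j) (column j (W $ i)))"
  shows "(\<beta>, rotate_beams \<theta> W, tx_slack \<eta> W, rx_slack h \<nu> W)
    \<in> feasible (P2 h \<eta> \<nu> \<sigma> L Q q \<delta> g \<gamma>)"
proof -
  note f = feas[unfolded mem_feasible_P1]
  have signal: "hprod (h i i j) (column j (rotate_beams \<theta> W $ i))
      = of_real (cmod (hprod (h i i j) (column j (W $ i))))" for i j
  proof -
    let ?z = "hprod (h i i j) (column j (W $ i))"
    \<comment> \<open>The polar form holds for a zero signal as well, so no case distinction
      arises.\<close>
    have "cis (- Arg ?z) * ?z = cis (- Arg ?z) * (of_real (cmod ?z) * cis (Arg ?z))"
      using rcis_cmod_Arg[of ?z] by (simp add: rcis_def)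
    also have "\<dots> = of_real (cmod ?z)"
      by (simp add: cis_mult mult.left_commute)
    finally show ?thesis by (simp add: hprod_column_rotate \<theta>_def)
  qed
  show ?thesis
    \<comment> \<open>By rotation invariance all remaining conditions concern the original
      \<open>W\<close>.\<close>
    unfolding mem_feasible_P2 signal slack_rotate total_power_rotate trace_quadratic_rotate
  proof (intro conjI allI ballI)
    show "qos_fun (g i j) (\<gamma> i j) (sqrt (total_power h \<sigma> W (tx_slack \<eta> W) (rx_slack h \<nu> W) i j))
        (Re (of_real (cmod (hprod (h i i j) (column j (W $ i)))))) \<le> 0" for i j
      unfolding Re_complex_of_real using f g noise targets by (subst qos_iff_SINR) simp_all
  qed (use f in \<open>simp_all add: tx_slack_def tx_distortion_def rx_slack_def eta nu rx_power_nonneg\<close>)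
qed

text \<open>Both passages between feasible points keep \<open>\<beta>\<close>, which is the whole
  objective; the claims on values and optimal points follow from this.\<close>

theorem theorem1:
  fixes h :: "('c::finite, 'u::finite, 'a::finite) channel"
    and \<eta> \<nu> :: "real \<Rightarrow> real" and \<sigma> \<delta> :: real
    and L :: "'c \<Rightarrow> nat" and Q :: "'c \<Rightarrow> nat \<Rightarrow> complex^'a^'a" and q :: "'c \<Rightarrow> nat \<Rightarrow> real"
    and g :: "'c \<Rightarrow> 'u \<Rightarrow> real \<Rightarrow> real" and \<gamma> :: "'c \<Rightarrow> 'u \<Rightarrow> real"
  assumes eta: "\<And>x. 0 \<le> x \<Longrightarrow> 0 \<le> \<eta> x" "mono_on {0..} \<eta>" "continuous_on {0..} \<eta>"
      "convex_on {0..} \<eta>"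
    and nu: "\<And>x. 0 \<le> x \<Longrightarrow> 0 \<le> \<nu> x" "mono_on {0..} \<nu>" "continuous_on {0..} \<nu>"
      "convex_on {0..} \<nu>"
    and noise: "0 < \<sigma>"
    and delta: "0 \<le> \<delta>" "\<delta> \<le> 1"
    and Q_psd: "\<And>i k. k \<in> {1..L i} \<Longrightarrow> psd (Q i k)"
    and Q_sum: "\<And>i. pos_def (\<Sum>k = 1..L i. Q i k)"
    and g: "\<And>i j. strict_mono_on {0..} (g i j)" "\<And>i j. continuous_on {0..} (g i j)"
      "\<And>i j. g i j 0 = 0"
    and targets: "\<And>i j. 0 \<le> \<gamma> i j"
  defines "Orig \<equiv> P1 h \<eta> \<nu> \<sigma> L Q q \<delta> g \<gamma>"
    and "Conv \<equiv> P2 h \<eta> \<nu> \<sigma> L Q q \<delta> g \<gamma>"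
  shows "convex_problem Conv
    \<and> (\<forall>\<beta> W t r. (\<beta>, W, t, r) \<in> feasible Conv \<longrightarrow> (\<beta>, W) \<in> feasible Orig)
    \<and> (\<forall>\<beta> W. (\<beta>, W) \<in> feasible Orig \<longrightarrow>
         (\<exists>\<theta> t r. (\<beta>, rotate_beams \<theta> W, t, r) \<in> feasible Conv))
    \<and> opt_value Conv = opt_value Orig
    \<and> (\<forall>\<beta> W t r. is_optimal Conv (\<beta>, W, t, r) \<longrightarrow> is_optimal Orig (\<beta>, W))
    \<and> (\<forall>\<beta> W. is_optimal Orig (\<beta>, W) \<longrightarrow>
         (\<exists>\<theta> t r. is_optimal Conv (\<beta>, rotate_beams \<theta> W, t, r)))"
proof -
  have to_Orig: "(\<beta>, W) \<in> feasible Orig" if "(\<beta>, W, t, r) \<in> feasible Conv" for \<beta> W t r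
    unfolding Orig_def
    by (rule feasible_P2_imp_P1[OF eta(1) nu(1) noise delta(1) Q_psd g targets
          that[unfolded Conv_def]])
  have to_Conv: "\<exists>\<theta> t r. (\<beta>, rotate_beams \<theta> W, t, r) \<in> feasible Conv"
    if "(\<beta>, W) \<in> feasible Orig" for \<beta> W
    using feasible_P1_imp_P2[OF eta(1) nu(1) noise g targets that[unfolded Orig_def]]
    unfolding Conv_def by blast
  have obj: "objective Orig (\<beta>, W) = \<beta>" "objective Conv (\<beta>, W, t, r) = \<beta>" for \<beta> W t r
    by (simp_all add: Orig_def Conv_def P1_def P2_def)
  have "opt_value Conv = opt_value Orig"
    unfolding opt_value_def
  proof (rule INF_eq)
    show "\<exists>y\<in>feasible Orig. ereal (objective Orig y) \<le> ereal (objective Conv x)"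
      if "x \<in> feasible Conv" for x
    proof (cases x)
      case (fields \<beta> W t r)
      then show ?thesis using to_Orig that by (intro bexI[of _ "(\<beta>, W)"]) (auto simp: obj)
    qed
    show "\<exists>x\<in>feasible Conv. ereal (objective Conv x) \<le> ereal (objective Orig y)"
      if y: "y \<in> feasible Orig" for y
    proof (cases y)
      case (Pair \<beta> W)
      with to_Conv y obtain \<theta> t r where "(\<beta>, rotate_beams \<theta> W, t, r) \<in> feasible Conv" by blast
      then show ?thesis by (rule bexI[rotated]) (simp add: obj Pair)
    qed
  qed
  moreover have "is_optimal Orig (\<beta>, W)" if "is_optimal Conv (\<beta>, W, t, r)" for \<beta> W t r
    unfolding is_optimal_def
  proof (intro conjI ballI)
    show "(\<beta>, W) \<in> feasible Orig" using that to_Orig unfolding is_optimal_def by blast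
    fix y assume y: "y \<in> feasible Orig"
    obtain \<beta>' W' where y_eq: "y = (\<beta>', W')" by (cases y)
    \<comment> \<open>A competitor in the original problem is compared through its rotated
      counterpart, which has the same objective.\<close>
    with to_Conv y obtain \<theta> t' r' where "(\<beta>', rotate_beams \<theta> W', t', r') \<in> feasible Conv"
      by blast
    with that show "objective Orig (\<beta>, W) \<le> objective Orig y"
      unfolding is_optimal_def y_eq obj by (metis obj(2))
  qed
  moreover have "is_optimal Conv (\<beta>, rotate_beams \<theta> W, t, r)"
    if "is_optimal Orig (\<beta>, W)" "(\<beta>, rotate_beams \<theta> W, t, r) \<in> feasible Conv" for \<beta> W \<theta> t r
    unfolding is_optimal_def
  proof (intro conjI ballI)
    fix x assume x: "x \<in> feasible Conv"
    obtain \<beta>' W' t' r' where x_eq: "x = (\<beta>', W', t', r')" by (cases x)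
    with to_Orig x have "(\<beta>', W') \<in> feasible Orig" by blast
    with that(1) show "objective Conv (\<beta>, rotate_beams \<theta> W, t, r) \<le> objective Conv x"
      unfolding is_optimal_def x_eq obj by (metis obj(1))
  qed (rule that(2))
  moreover have "(\<beta>, W) \<in> feasible Orig" if "is_optimal Orig (\<beta>, W)" for \<beta> W
    using that by (simp add: is_optimal_def)
  moreover have "convex_problem Conv"
    unfolding Conv_def by (rule convex_problem_P2[OF eta(2,4) nu(2,4) delta(1) Q_psd])
  ultimately show ?thesis using to_Orig to_Conv by meson
qed

end
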